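(* The process $\mathsf{Process\_instruction}$ (defined in the context) satisfies \texttt{positive bid-ask spread}, \texttt{price-time priority} and \texttt{conservation}.
   Context: An order is a 4-tuple $\omega=(\mathsf{id}(\omega),\mathsf{timestamp}(\omega),\mathsf{qty}(\omega),\mathsf{price}(\omega))$ of natural numbers with $\mathsf{qty}(\omega)>0$. An order-domain is a pair $(B,A)$ of finite sets of orders ($B$ = bids, $A$ = asks); it is admissible if all orders in $B\cup A$ have pairwise distinct ids and pairwise distinct timestamps. A bid $b$ and ask $a$ are tradable if $\mathsf{price}(b)\ge\mathsf{price}(a)$; $(B,A)$ is matchable if some $b\in B$, $a\in A$ are tradable. Competitiveness: bid $b_1\succ b_2$ iff $\mathsf{price}(b_1)>\mathsf{price}(b_2)$, or prices equal and $\mathsf{timestamp}(b_1)<\mathsf{timestamp}(b_2)$; ask $a_1\succ a_2$ iff $\mathsf{price}(a_1)<\mathsf{price}(a_2)$, or prices equal and $\mathsf{timestamp}(a_1)<\mathsf{timestamp}(a_2)$. A transaction is a triple $t=(\mathsf{id_{bid}}(t),\mathsf{id_{ask}}(t),\mathsf{qty}(t))$ of natural numbers with $\mathsf{qty}(t)>0$; it is valid w.r.t. $(B,A)$ if there are $b\in B$, $a\in A$ with $\mathsf{id_{bid}}(t)=\mathsf{id}(b)$, $\mathsf{id_{ask}}(t)=\mathsf{id}(a)$, $b,a$ tradable, and $\mathsf{qty}(t)\le\min(\mathsf{qty}(b),\mathsf{qty}(a))$. $\mathsf{Qty}(T,id)$ is the sum of quantities of transactions in $T$ whose bid id (for a bid)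 resp. ask id (for an ask) equals $id$; $\mathsf{ids_{bid}}(T),\mathsf{ids_{ask}}(T)$ are the sets of bid/ask ids in $T$. A matching over an admissible $(B,A)$ is a set $M$ of valid transactions with $\mathsf{Qty}(M,\mathsf{id}(\omega))\le\mathsf{qty}(\omega)$ for all $\omega\in B\cup A$. $\mathsf{Bids}(M,B)$ is the set of bids of $B$ occurring in $M$ with quantity replaced by $\mathsf{Qty}(M,\mathsf{id}(b))$; $\mathsf{Asks}(M,A)$ likewise. Sets of orders are viewed as multisets (each order, quantity suppressed, with multiplicity its quantity); $S_1-S_2$ is multiset difference. An instruction is $\mathsf{Buy}\ \beta$, $\mathsf{Sell}\ \alpha$ or $\mathsf{Del}\ id$. $\mathsf{Absorb}(B,A,\mathsf{Del}\ id)=(\{b\in B:\mathsf{id}(b)\ne id\},\{a\in A:\mathsf{id}(a)\ne id\})$, $\mathsf{Absorb}(B,A,\mathsf{Buy}\ \beta)=(B\cup\{\beta\},A)$, $\mathsf{Absorb}(B,A,\mathsf{Sell}\ \alpha)=(B,A\cup\{\alpha\})$. $((B,A),\tau)$ is a legal-input if $(B,A)$ is not matchable and $\mathsf{Absorb}(B,A,\tau)$ is admissible. A process is a function $P:(B,A,\tau)\mapsto(\hat B,\hat A,M)$. For every legal-input with $P(B,A,\tau)=(\hat B,\hat A,M)$ and $(B',A')=\mathsf{Absorb}(B,A,\tau)$, $P$ satisfies: \texttt{positive bid-ask spread} if $(\hat B,\hat A)$ is not matchable; \texttt{price-time priority} if for all $a,a'\in A'$ with $a\succ a'$ and $\mathsf{id}(a')\in\mathsf{ids_{ask}}(M)$,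 $\mathsf{Qty}(M,\mathsf{id}(a))=\mathsf{qty}(a)$, and for all $b,b'\in B'$ with $b\succ b'$ and $\mathsf{id}(b')\in\mathsf{ids_{bid}}(M)$, $\mathsf{Qty}(M,\mathsf{id}(b))=\mathsf{qty}(b)$; \texttt{conservation} if $M$ is a matching over $(B',A')$, $\hat B=B'-\mathsf{Bids}(M,B')$, $\hat A=A'-\mathsf{Asks}(M,A')$. A process satisfies a property if it does so for all legal-inputs. The algorithm: $\mathsf{Process\_instruction}(B,A,\mathsf{Buy}\ \beta)=\mathsf{Match\_Bid}(B,A,\beta)$, $\mathsf{Process\_instruction}(B,A,\mathsf{Sell}\ \alpha)=\mathsf{Match\_Ask}(B,A,\alpha)$, $\mathsf{Process\_instruction}(B,A,\mathsf{Del}\ id)=\mathsf{Del\_Order}(B,A,id)=(\{b\in B:\mathsf{id}(b)\ne id\},\{a\in A:\mathsf{id}(a)\ne id\},\emptyset)$. $\mathsf{Match\_Ask}(B,A,\alpha)$: if $B=\emptyset$ return $(B,A\cup\{\alpha\},\emptyset)$. Otherwise let $\beta$ be the most competitive bid in $B$. If $\beta,\alpha$ are not tradable, return $(B,A\cup\{\alpha\},\emptyset)$. If $\mathsf{qty}(\beta)=\mathsf{qty}(\alpha)$, return $(B\setminus\{\beta\},A,\{(\mathsf{id}(\beta),\mathsf{id}(\alpha),\mathsf{qty}(\alpha))\})$. If $\mathsf{qty}(\beta)>\mathsf{qty}(\alpha)$, return $((B\setminus\{\beta\})\cup\{\beta'\},A,\{(\mathsf{id}(\beta),\mathsf{id}(\alpha),\mathsf{qty}(\alpha))\})$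 where $\beta'$ equals $\beta$ except $\mathsf{qty}(\beta')=\mathsf{qty}(\beta)-\mathsf{qty}(\alpha)$. If $\mathsf{qty}(\beta)<\mathsf{qty}(\alpha)$, let $\alpha'$ equal $\alpha$ except $\mathsf{qty}(\alpha')=\mathsf{qty}(\alpha)-\mathsf{qty}(\beta)$, compute $(B'',A'',M'')=\mathsf{Match\_Ask}(B\setminus\{\beta\},A,\alpha')$ and return $(B'',A'',M''\cup\{(\mathsf{id}(\beta),\mathsf{id}(\alpha),\mathsf{qty}(\beta))\})$. $\mathsf{Match\_Bid}(B,A,\beta)$ is the symmetric procedure with roles of bids and asks exchanged (matching the incoming bid $\beta$ against the most competitive ask in $A$, recursively, with transactions $(\mathsf{id}(\beta),\mathsf{id}(a),q)$). *)

theory Defs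
  imports Main "HOL-Library.Multiset"
begin

record order =
  oid :: nat
  timestamp :: nat
  qty :: nat
  price :: nat

record transaction =
  id_bid :: nat
  id_ask :: nat
  tqty :: nat

datatype instruction = Buy order | Sell order | Del nat

text \<open>Positivity of quantities is not built into the record types. It is imposed by
  \<open>order_domain\<close> and \<open>instruction_ok\<close> for orders, and by \<open>valid_transaction\<close> for transactions.\<close>

definition order_domain :: "order set \<Rightarrow> order set \<Rightarrow> bool" where
  "order_domain B A \<longleftrightarrow> finite B \<and> finite A \<and> (\<forall>w \<in> B \<union> A. qty w > 0)"

fun instruction_ok :: "instruction \<Rightarrow> bool" where
  "instruction_ok (Buy b) \<longleftrightarrow> qty b > 0"
| "instruction_ok (Sell a) \<longleftrightarrow> qty a > 0"
| "instruction_ok (Del i) \<longleftrightarrow> True"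

definition admissible :: "order set \<Rightarrow> order set \<Rightarrow> bool" where
  "admissible B A \<longleftrightarrow> inj_on oid (B \<union> A) \<and> inj_on timestamp (B \<union> A)"

definition tradable :: "order \<Rightarrow> order \<Rightarrow> bool" where
  "tradable b a \<longleftrightarrow> price b \<ge> price a"

definition matchable :: "order set \<Rightarrow> order set \<Rightarrow> bool" where
  "matchable B A \<longleftrightarrow> (\<exists>b\<in>B. \<exists>a\<in>A. tradable b a)"

definition bid_more_competitive :: "order \<Rightarrow> order \<Rightarrow> bool" where
  "bid_more_competitive b1 b2 \<longleftrightarrow>
     price b1 > price b2 \<or> (price b1 = price b2 \<and> timestamp b1 < timestamp b2)"

definition ask_more_competitive :: "order \<Rightarrow> order \<Rightarrow> bool" where
  "ask_more_competitive a1 a2 \<longleftrightarrow>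
     price a1 < price a2 \<or> (price a1 = price a2 \<and> timestamp a1 < timestamp a2)"

definition valid_transaction :: "order set \<Rightarrow> order set \<Rightarrow> transaction \<Rightarrow> bool" where
  "valid_transaction B A t \<longleftrightarrow> tqty t > 0 \<and>
     (\<exists>b\<in>B. \<exists>a\<in>A. id_bid t = oid b \<and> id_ask t = oid a \<and> tradable b a
        \<and> tqty t \<le> min (qty b) (qty a))"

text \<open>Over an order-domain only finitely many transactions are valid, so the sums below never
  degenerate on a matching.\<close>

definition Qty_bid :: "transaction set \<Rightarrow> nat \<Rightarrow> nat" where
  "Qty_bid T i = (\<Sum>t \<in> {t \<in> T. id_bid t = i}. tqty t)"

definition Qty_ask :: "transaction set \<Rightarrow> nat \<Rightarrow> nat" where
  "Qty_ask T i = (\<Sum>t \<in> {t \<in> T. id_ask t = i}. tqty t)"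

definition ids_bid :: "transaction set \<Rightarrow> nat set" where
  "ids_bid T = id_bid ` T"

definition ids_ask :: "transaction set \<Rightarrow> nat set" where
  "ids_ask T = id_ask ` T"

definition matching :: "order set \<Rightarrow> order set \<Rightarrow> transaction set \<Rightarrow> bool" where
  "matching B A M \<longleftrightarrow> order_domain B A \<and> admissible B A
     \<and> (\<forall>t\<in>M. valid_transaction B A t)
     \<and> (\<forall>b\<in>B. Qty_bid M (oid b) \<le> qty b)
     \<and> (\<forall>a\<in>A. Qty_ask M (oid a) \<le> qty a)"

definition Bids :: "transaction set \<Rightarrow> order set \<Rightarrow> order set" where
  "Bids M B = (\<lambda>b. b\<lparr>qty := Qty_bid M (oid b)\<rparr>) ` {b \<in> B. oid b \<in> ids_bid M}"

definition Asks :: "transaction set \<Rightarrow> order set \<Rightarrow> order set" where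
  "Asks M A = (\<lambda>a. a\<lparr>qty := Qty_ask M (oid a)\<rparr>) ` {a \<in> A. oid a \<in> ids_ask M}"

text \<open>A set of orders is viewed as a multiset over orders with the quantity suppressed, the
  quantity being the multiplicity; \<open>orders_of_mset\<close> reads such a multiset back as a set of
  orders (see \<open>orders_of_mset_of_orders\<close> and \<open>mset_of_orders_of_mset\<close>).\<close>

definition order_key :: "order \<Rightarrow> nat \<times> nat \<times> nat" where
  "order_key w = (oid w, timestamp w, price w)"

definition mset_of_orders :: "order set \<Rightarrow> (nat \<times> nat \<times> nat) multiset" where
  "mset_of_orders S = (\<Sum>w\<in>S. replicate_mset (qty w) (order_key w))"

definition orders_of_mset :: "(nat \<times> nat \<times> nat) multiset \<Rightarrow> order set" where
  "orders_of_mset N = {w. qty w > 0 \<and> qty w = count N (order_key w)}"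

definition order_diff :: "order set \<Rightarrow> order set \<Rightarrow> order set" where
  "order_diff S1 S2 = orders_of_mset (mset_of_orders S1 - mset_of_orders S2)"

lemma count_mset_of_orders:
  "finite S \<Longrightarrow> count (mset_of_orders S) k = (\<Sum>w \<in> {w \<in> S. order_key w = k}. qty w)"
  by (simp add: mset_of_orders_def count_sum sum.inter_filter eq_commute[of k])

lemma orders_of_mset_of_orders:
  assumes "finite S" "\<forall>w\<in>S. qty w > 0" "inj_on oid S"
  shows "orders_of_mset (mset_of_orders S) = S"
proof -
  have cnt: "count (mset_of_orders S) (order_key w) = qty w" if "w \<in> S" for w
  proof -
    have "{v \<in> S. order_key v = order_key w} = {w}"
      using that assms(3) by (auto simp: order_key_def inj_on_def)
    then show ?thesis
      using assms(1) by (simp add: count_mset_of_orders)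
  qed
  have sub: "w \<in> S" if w: "qty w > 0" "qty w = count (mset_of_orders S) (order_key w)" for w
  proof -
    have "{v \<in> S. order_key v = order_key w} \<noteq> {}"
      using w unfolding count_mset_of_orders[OF assms(1)]
      by (metis (no_types, lifting) less_irrefl sum.empty)
    then obtain v where v: "v \<in> S" "order_key v = order_key w"
      by blast
    then have "qty v = qty w"
      using cnt[of v] w by metis
    with v have "v = w"
      by (intro order.equality) (simp_all add: order_key_def)
    with v show ?thesis by simp
  qed
  show ?thesis
  proof (intro set_eqI iffI)
    fix w assume "w \<in> orders_of_mset (mset_of_orders S)"
    then show "w \<in> S"
      unfolding orders_of_mset_def using sub by blast
  next
    fix w assume "w \<in> S"
    then show "w \<in> orders_of_mset (mset_of_orders S)"
      unfolding orders_of_mset_def using cnt[of w] assms(2) by simp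
  qed
qed

lemma mset_of_orders_of_mset: "mset_of_orders (orders_of_mset N) = N"
proof -
  define mk where "mk = (\<lambda>k. \<lparr>oid = fst k, timestamp = fst (snd k),
    qty = count N k, price = snd (snd k)\<rparr>)"
  have mk: "order_key (mk k) = k" "qty (mk k) = count N k" for k
    by (auto simp: mk_def order_key_def)
  have eq: "orders_of_mset N = mk ` set_mset N"
  proof (intro set_eqI iffI)
    fix w assume "w \<in> orders_of_mset N"
    then have w: "qty w > 0" "qty w = count N (order_key w)"
      unfolding orders_of_mset_def by blast+
    then have "order_key w \<in># N"
      by (metis count_greater_zero_iff)
    moreover have "w = mk (order_key w)"
      unfolding mk_def w(2)[symmetric] by (simp add: order_key_def)
    ultimately show "w \<in> mk ` set_mset N" by blast
  qed (auto simp: orders_of_mset_def mk)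
  have "inj mk"
    using mk(1) by (metis injI)
  then have "mset_of_orders (orders_of_mset N) = (\<Sum>k\<in>set_mset N. replicate_mset (count N k) k)"
    unfolding mset_of_orders_def eq
    by (subst sum.reindex) (auto simp: mk intro: inj_on_subset)
  also have "\<dots> = N"
    by (rule multiset_eqI) (simp add: count_sum not_in_iff)
  finally show ?thesis .
qed

fun Absorb :: "order set \<Rightarrow> order set \<Rightarrow> instruction \<Rightarrow> order set \<times> order set" where
  "Absorb B A (Del i) = ({b \<in> B. oid b \<noteq> i}, {a \<in> A. oid a \<noteq> i})"
| "Absorb B A (Buy b) = (B \<union> {b}, A)"
| "Absorb B A (Sell a) = (B, A \<union> {a})"

definition legal_input :: "order set \<Rightarrow> order set \<Rightarrow> instruction \<Rightarrow> bool" where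
  "legal_input B A \<tau> \<longleftrightarrow> order_domain B A \<and> instruction_ok \<tau> \<and> \<not> matchable B A
     \<and> (case Absorb B A \<tau> of (B', A') \<Rightarrow> admissible B' A')"

type_synonym process =
  "order set \<Rightarrow> order set \<Rightarrow> instruction \<Rightarrow> order set \<times> order set \<times> transaction set"

definition positive_bid_ask_spread :: "process \<Rightarrow> bool" where
  "positive_bid_ask_spread P \<longleftrightarrow>
     (\<forall>B A \<tau> Bh Ah M. legal_input B A \<tau> \<longrightarrow> P B A \<tau> = (Bh, Ah, M) \<longrightarrow> \<not> matchable Bh Ah)"

definition price_time_priority :: "process \<Rightarrow> bool" where
  "price_time_priority P \<longleftrightarrow>
     (\<forall>B A \<tau> Bh Ah M B' A'. legal_input B A \<tau> \<longrightarrow> P B A \<tau> = (Bh, Ah, M) \<longrightarrow>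
        Absorb B A \<tau> = (B', A') \<longrightarrow>
        (\<forall>a\<in>A'. \<forall>a'\<in>A'. ask_more_competitive a a' \<and> oid a' \<in> ids_ask M
            \<longrightarrow> Qty_ask M (oid a) = qty a) \<and>
        (\<forall>b\<in>B'. \<forall>b'\<in>B'. bid_more_competitive b b' \<and> oid b' \<in> ids_bid M
            \<longrightarrow> Qty_bid M (oid b) = qty b))"

definition conservation :: "process \<Rightarrow> bool" where
  "conservation P \<longleftrightarrow>
     (\<forall>B A \<tau> Bh Ah M B' A'. legal_input B A \<tau> \<longrightarrow> P B A \<tau> = (Bh, Ah, M) \<longrightarrow>
        Absorb B A \<tau> = (B', A') \<longrightarrow>
        matching B' A' M \<and> Bh = order_diff B' (Bids M B') \<and> Ah = order_diff A' (Asks M A'))"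

text \<open>The choice in \<open>most_competitive\<close> is irrelevant on sets with pairwise distinct
  timestamps, where the maximal element is unique and beats every other element
  (lemmas \<open>most_competitive_bid\<close> and \<open>most_competitive_ask\<close>).
  Allowing any maximal element makes it well defined on all finite nonempty sets,
  which gives termination of the matching procedures.\<close>

definition most_competitive :: "(order \<Rightarrow> order \<Rightarrow> bool) \<Rightarrow> order set \<Rightarrow> order" where
  "most_competitive R S = (SOME x. x \<in> S \<and> (\<forall>y\<in>S. \<not> R y x))"

lemma most_competitive_maximal:
  assumes "finite S" "S \<noteq> {}" "asymp R" "transp R"
  shows "most_competitive R S \<in> S \<and> (\<forall>y\<in>S. \<not> R y (most_competitive R S))"
proof -
  have "\<exists>m\<in>S. \<forall>x\<in>S. x \<noteq> m \<longrightarrow> \<not> R x m"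
    using assms Finite_Set.bex_min_element[of S R]
    by (meson asymp_on_subset transp_on_subset subset_UNIV)
  then have "\<exists>m. m \<in> S \<and> (\<forall>x\<in>S. \<not> R x m)"
    using assms(3) by (metis asympD)
  then show ?thesis
    unfolding most_competitive_def by (rule someI_ex)
qed

lemma competitive_order:
  "asymp bid_more_competitive" "transp bid_more_competitive"
  "asymp ask_more_competitive" "transp ask_more_competitive"
  by (auto simp: bid_more_competitive_def ask_more_competitive_def intro!: asympI transpI)

lemma most_competitive_bid:
  assumes "finite B" "B \<noteq> {}" "inj_on timestamp B"
  shows "most_competitive bid_more_competitive B \<in> B"
    and "b \<in> B \<Longrightarrow> b \<noteq> most_competitive bid_more_competitive B
      \<Longrightarrow> bid_more_competitive (most_competitive bid_more_competitive B) b"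
proof -
  let ?m = "most_competitive bid_more_competitive B"
  have max: "?m \<in> B" "\<forall>y\<in>B. \<not> bid_more_competitive y ?m"
    using most_competitive_maximal[OF assms(1,2) competitive_order(1,2)] by auto
  show "?m \<in> B" by (fact max)
  show "bid_more_competitive ?m b" if "b \<in> B" "b \<noteq> ?m"
  proof -
    have "timestamp b \<noteq> timestamp ?m"
      using that max(1) assms(3) by (meson inj_onD)
    moreover have "\<not> bid_more_competitive b ?m"
      using that max(2) by blast
    ultimately show ?thesis
      unfolding bid_more_competitive_def by linarith
  qed
qed

lemma most_competitive_ask:
  assumes "finite A" "A \<noteq> {}" "inj_on timestamp A"
  shows "most_competitive ask_more_competitive A \<in> A"
    and "a \<in> A \<Longrightarrow> a \<noteq> most_competitive ask_more_competitive A
      \<Longrightarrow> ask_more_competitive (most_competitive ask_more_competitive A) a"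
proof -
  let ?m = "most_competitive ask_more_competitive A"
  have max: "?m \<in> A" "\<forall>y\<in>A. \<not> ask_more_competitive y ?m"
    using most_competitive_maximal[OF assms(1,2) competitive_order(3,4)] by auto
  show "?m \<in> A" by (fact max)
  show "ask_more_competitive ?m a" if "a \<in> A" "a \<noteq> ?m"
  proof -
    have "timestamp a \<noteq> timestamp ?m"
      using that max(1) assms(3) by (meson inj_onD)
    moreover have "\<not> ask_more_competitive a ?m"
      using that max(2) by blast
    ultimately show ?thesis
      unfolding ask_more_competitive_def by linarith
  qed
qed

text \<open>The infinite case of the first test only makes the functions total;
  order-domains are finite.\<close>

function Match_Ask ::
  "order set \<Rightarrow> order set \<Rightarrow> order \<Rightarrow> order set \<times> order set \<times> transaction set" where
  "Match_Ask B A \<alpha> =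
    (if infinite B \<or> B = {} then (B, A \<union> {\<alpha>}, {})
     else let \<beta> = most_competitive bid_more_competitive B in
       if \<not> tradable \<beta> \<alpha> then (B, A \<union> {\<alpha>}, {})
       else if qty \<beta> = qty \<alpha> then
         (B - {\<beta>}, A, {\<lparr>id_bid = oid \<beta>, id_ask = oid \<alpha>, tqty = qty \<alpha>\<rparr>})
       else if qty \<beta> > qty \<alpha> then
         ((B - {\<beta>}) \<union> {\<beta>\<lparr>qty := qty \<beta> - qty \<alpha>\<rparr>}, A,
          {\<lparr>id_bid = oid \<beta>, id_ask = oid \<alpha>, tqty = qty \<alpha>\<rparr>})
       else
         let (B'', A'', M'') = Match_Ask (B - {\<beta>}) A (\<alpha>\<lparr>qty := qty \<alpha> - qty \<beta>\<rparr>)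
         in (B'', A'', M'' \<union> {\<lparr>id_bid = oid \<beta>, id_ask = oid \<alpha>, tqty = qty \<beta>\<rparr>}))"
  by pat_completeness auto
termination
  by (relation "measure (\<lambda>(B, A, \<alpha>). card B)")
     (auto intro!: diff_less simp: card_gt_0_iff most_competitive_maximal competitive_order)

function Match_Bid ::
  "order set \<Rightarrow> order set \<Rightarrow> order \<Rightarrow> order set \<times> order set \<times> transaction set" where
  "Match_Bid B A \<beta> =
    (if infinite A \<or> A = {} then (B \<union> {\<beta>}, A, {})
     else let \<alpha> = most_competitive ask_more_competitive A in
       if \<not> tradable \<beta> \<alpha> then (B \<union> {\<beta>}, A, {})
       else if qty \<alpha> = qty \<beta> then
         (B, A - {\<alpha>}, {\<lparr>id_bid = oid \<beta>, id_ask = oid \<alpha>, tqty = qty \<beta>\<rparr>})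
       else if qty \<alpha> > qty \<beta> then
         (B, (A - {\<alpha>}) \<union> {\<alpha>\<lparr>qty := qty \<alpha> - qty \<beta>\<rparr>},
          {\<lparr>id_bid = oid \<beta>, id_ask = oid \<alpha>, tqty = qty \<beta>\<rparr>})
       else
         let (B'', A'', M'') = Match_Bid B (A - {\<alpha>}) (\<beta>\<lparr>qty := qty \<beta> - qty \<alpha>\<rparr>)
         in (B'', A'', M'' \<union> {\<lparr>id_bid = oid \<beta>, id_ask = oid \<alpha>, tqty = qty \<alpha>\<rparr>}))"
  by pat_completeness auto
termination
  by (relation "measure (\<lambda>(B, A, \<beta>). card A)")
     (auto intro!: diff_less simp: card_gt_0_iff most_competitive_maximal competitive_order)

declare Match_Ask.simps [simp del] Match_Bid.simps [simp del]

definition Del_Order ::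
  "order set \<Rightarrow> order set \<Rightarrow> nat \<Rightarrow> order set \<times> order set \<times> transaction set" where
  "Del_Order B A i = ({b \<in> B. oid b \<noteq> i}, {a \<in> A. oid a \<noteq> i}, {})"

fun Process_instruction :: process where
  "Process_instruction B A (Buy \<beta>) = Match_Bid B A \<beta>"
| "Process_instruction B A (Sell \<alpha>) = Match_Ask B A \<alpha>"
| "Process_instruction B A (Del i) = Del_Order B A i"

end

theory Submission imports Defs begin

text \<open>An incoming order with quantity \<open>q\<close> consumes the opposite side \<open>S\<close> of the book in order
  of competitiveness. The whole run is determined by how much, \<open>f w\<close>, is taken from each resting
  order \<open>w \<in> S\<close> and by the quantity \<open>r\<close> left over: the book keeps \<open>qty w - f w\<close> of each \<open>w\<close>, and
  each \<open>w\<close> with \<open>f w > 0\<close> contributes one transaction of quantity \<open>f w\<close>. On the side of the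
  incoming order, price-time priority holds vacuously: an order beating the incoming one would
  itself be tradable with the opposite side, but the book was not matchable before.\<close>

definition greedy_fill ::
  "(order \<Rightarrow> order \<Rightarrow> bool) \<Rightarrow> (order \<Rightarrow> bool) \<Rightarrow> order set \<Rightarrow> nat \<Rightarrow> (order \<Rightarrow> nat) \<Rightarrow> nat \<Rightarrow> bool"
where
  "greedy_fill R ok S q f r \<longleftrightarrow>
     (\<forall>w\<in>S. f w \<le> qty w) \<and> sum f S + r = q \<and> (\<forall>w\<in>S. 0 < f w \<longrightarrow> ok w)
     \<and> (\<forall>w\<in>S. \<forall>w'\<in>S. R w w' \<and> 0 < f w' \<longrightarrow> f w = qty w)
     \<and> (0 < r \<longrightarrow> (\<forall>w\<in>S. ok w \<longrightarrow> f w = qty w))"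

text \<open>A book contains only positive quantities, hence the filter. Residual books arise from
  \<open>g w = qty w - f w\<close>, and \<open>Bids\<close> and \<open>Asks\<close> from the traded
  quantities, so conservation reduces to comparing functions \<open>g\<close>.\<close>

definition requantify :: "order set \<Rightarrow> (order \<Rightarrow> nat) \<Rightarrow> order set" where
  "requantify S g = (\<lambda>w. w\<lparr>qty := g w\<rparr>) ` {w \<in> S. 0 < g w}"

lemma requantify_cong:
  "(\<And>w. w \<in> S \<Longrightarrow> f w = g w) \<Longrightarrow> requantify S f = requantify S g"
  unfolding requantify_def by (rule image_cong) auto

lemma requantify_insert:
  "requantify (insert x S) g = (if 0 < g x then {x\<lparr>qty := g x\<rparr>} else {}) \<union> requantify S g"
  by (auto simp: requantify_def)

lemma requantify_same:
  assumes "\<forall>w\<in>S. 0 < qty w" "\<And>w. w \<in> S \<Longrightarrow> g w = qty w"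
  shows "requantify S g = S"
proof -
  have "requantify S g = requantify S qty"
    by (rule requantify_cong) (rule assms(2))
  also have "\<dots> = S"
    using assms(1) by (auto simp: requantify_def image_iff)
  finally show ?thesis .
qed

lemma requantify_remove:
  assumes "m \<in> S"
  shows "requantify S g = (if 0 < g m then {m\<lparr>qty := g m\<rparr>} else {}) \<union> requantify (S - {m}) g"
  using requantify_insert[of m "S - {m}" g] assms by (simp add: insert_absorb)

subsection \<open>Greedy fills\<close>

text \<open>Everything is left over, and the clause for a positive remainder is vacuous because no
  order is acceptable.\<close>

lemma greedy_fill_stop:
  assumes "\<forall>w\<in>S. \<not> ok w"
  shows "greedy_fill R ok S q (\<lambda>_. 0) q"
  using assms by (simp add: greedy_fill_def)

text \<open>At most \<open>m\<close> receives a positive share and nothing beats \<open>m\<close>,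
  so no pair falls under the priority clause; the remainder 0 switches off the last clause.\<close>

lemma greedy_fill_last:
  assumes "finite S" "m \<in> S" "ok m" "q \<le> qty m" "\<forall>w\<in>S. \<not> R w m"
  shows "greedy_fill R ok S q (\<lambda>w. if w = m then q else 0) 0"
  using assms by (auto simp: greedy_fill_def)

text \<open>This is the recursive branch of the procedures: the best order is emptied and the rest
  of the demand goes to the others. The bound \<open>qty m < q\<close> keeps the truncated
  subtraction exact in the sum.\<close>

lemma greedy_fill_step:
  assumes "finite S" "m \<in> S" "ok m" "qty m < q" "\<forall>w\<in>S. \<not> R w m"
    and "greedy_fill R ok (S - {m}) (q - qty m) f r"
  shows "greedy_fill R ok S q (f(m := qty m)) r"
proof -
  have "sum (f(m := qty m)) S = qty m + sum (f(m := qty m)) (S - {m})"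
    using assms(1,2) by (subst sum.remove[of S m]) auto
  also have "sum (f(m := qty m)) (S - {m}) = sum f (S - {m})"
    by (rule sum.cong) auto
  finally have total: "sum (f(m := qty m)) S + r = q"
    using assms(4,6) unfolding greedy_fill_def by linarith
  have rest: "\<forall>w\<in>S - {m}. f w \<le> qty w" "\<forall>w\<in>S - {m}. 0 < f w \<longrightarrow> ok w"
    "0 < r \<longrightarrow> (\<forall>w\<in>S - {m}. ok w \<longrightarrow> f w = qty w)"
    using assms(6) unfolding greedy_fill_def by blast+
  have "\<forall>w\<in>S. (f(m := qty m)) w \<le> qty w"
    "\<forall>w\<in>S. 0 < (f(m := qty m)) w \<longrightarrow> ok w"
    "0 < r \<longrightarrow> (\<forall>w\<in>S. ok w \<longrightarrow> (f(m := qty m)) w = qty w)"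
    using assms(3) rest by auto
  \<comment> \<open>Priority clause: by maximality the beaten \<open>w'\<close> is not
    \<open>m\<close>, so it lies in the remaining set. The better order is either \<open>m\<close>,
    which is emptied, or also lies there, where the smaller fill applies.\<close>
  moreover have "(f(m := qty m)) w = qty w"
    if "w \<in> S" "w' \<in> S" "R w w'" "0 < (f(m := qty m)) w'" for w w'
  proof -
    have "w' \<noteq> m"
      using that(1,3) assms(5) by blast
    then have "w \<noteq> m \<Longrightarrow> f w = qty w"
      using that assms(6) unfolding greedy_fill_def by (metis Diff_iff fun_upd_other singletonD)
    then show ?thesis by simp
  qed
  ultimately show ?thesis
    unfolding greedy_fill_def using total by blast
qed

text \<open>Untouched orders survive the filter by positivity. For \<open>q = qty m\<close> the
  order \<open>m\<close> disappears, so one formula covers both final branches of the procedures: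
  equal quantities and a larger resting quantity.\<close>

lemma requantify_last:
  assumes "m \<in> S" "\<forall>w\<in>S. 0 < qty w"
  shows "requantify S (\<lambda>w. qty w - (if w = m then q else 0)) =
    (if q < qty m then {m\<lparr>qty := qty m - q\<rparr>} else {}) \<union> (S - {m})"
proof -
  have "requantify (S - {m}) (\<lambda>w. qty w - (if w = m then q else 0)) = S - {m}"
    using assms by (intro requantify_same) auto
  then show ?thesis
    using requantify_remove[OF assms(1)] by simp
qed

lemma requantify_step:
  assumes "m \<in> S"
  shows "requantify S (\<lambda>w. qty w - (f(m := qty m)) w) = requantify (S - {m}) (\<lambda>w. qty w - f w)"
proof -
  have "requantify (S - {m}) (\<lambda>w. qty w - (f(m := qty m)) w)
      = requantify (S - {m}) (\<lambda>w. qty w - f w)"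
    by (rule requantify_cong) auto
  then show ?thesis
    using requantify_remove[OF assms, of "\<lambda>w. qty w - (f(m := qty m)) w"] by simp
qed

section \<open>Runs of the matching procedures as greedy fills\<close>

definition bid_trades :: "order set \<Rightarrow> nat \<Rightarrow> (order \<Rightarrow> nat) \<Rightarrow> transaction set" where
  "bid_trades B i f = (\<lambda>b. \<lparr>id_bid = oid b, id_ask = i, tqty = f b\<rparr>) ` {b \<in> B. 0 < f b}"

definition ask_trades :: "order set \<Rightarrow> nat \<Rightarrow> (order \<Rightarrow> nat) \<Rightarrow> transaction set" where
  "ask_trades A i f = (\<lambda>a. \<lparr>id_bid = i, id_ask = oid a, tqty = f a\<rparr>) ` {a \<in> A. 0 < f a}"

text \<open>Induction on the number of resting bids; the branches of the procedure match
  \<open>greedy_fill_stop\<close>, \<open>greedy_fill_last\<close> and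
  \<open>greedy_fill_step\<close>. The ask side is only touched at the end, when a positive
  remainder \<open>r\<close> is posted; without any trade \<open>r = qty \<alpha>\<close> and the
  posted order is \<open>\<alpha>\<close> itself.\<close>

lemma Match_Ask_greedy:
  assumes "finite B" "inj_on timestamp B" "\<forall>b\<in>B. 0 < qty b" "0 < qty \<alpha>"
  shows "\<exists>f r. greedy_fill bid_more_competitive (\<lambda>b. tradable b \<alpha>) B (qty \<alpha>) f r
    \<and> Match_Ask B A \<alpha> = (requantify B (\<lambda>b. qty b - f b),
        A \<union> (if 0 < r then {\<alpha>\<lparr>qty := r\<rparr>} else {}), bid_trades B (oid \<alpha>) f)"
  using assms
proof (induction "card B" arbitrary: B \<alpha> rule: less_induct)
  case less
  let ?R = bid_more_competitive
  let ?m = "most_competitive ?R B"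
  \<comment> \<open>The procedure tests only \<open>?m\<close>, while a greedy fill speaks of all
    bids. By distinct timestamps \<open>?m\<close> beats every other bid, so no bid has a higher
    price, and if \<open>?m\<close> is not tradable then none is.\<close>
  consider (stop) "\<forall>b\<in>B. \<not> tradable b \<alpha>" "B = {} \<or> \<not> tradable ?m \<alpha>"
    | (trade) "B \<noteq> {}" "tradable ?m \<alpha>"
  proof (cases "B = {} \<or> \<not> tradable ?m \<alpha>")
    case True
    have "\<not> tradable b \<alpha>" if "b \<in> B" for b
    proof (cases "b = ?m")
      case False
      then have "?R ?m b"
        using most_competitive_bid(2)[OF less.prems(1) _ less.prems(2)] that by blast
      then show ?thesis
        using True that by (auto simp: tradable_def bid_more_competitive_def)
    qed (use True that in auto)
    then show ?thesis using that(1) True by blast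
  qed (use that in blast)
  then show ?case
  proof cases
    case stop
    have "Match_Ask B A \<alpha> = (B, A \<union> {\<alpha>}, {})"
      using stop(2) by (subst Match_Ask.simps) (auto simp: Let_def)
    moreover have "requantify B (\<lambda>b. qty b - 0) = B"
      using less.prems by (intro requantify_same) auto
    moreover have "bid_trades B (oid \<alpha>) (\<lambda>_. 0) = {}"
      by (simp add: bid_trades_def)
    ultimately show ?thesis
      using greedy_fill_stop[OF stop(1), of ?R "qty \<alpha>"] less.prems(4)
      by (intro exI[of _ "\<lambda>_. 0"] exI[of _ "qty \<alpha>"]) simp
  next
    case trade
    have m: "?m \<in> B" "\<forall>b\<in>B. \<not> ?R b ?m"
      using most_competitive_maximal[OF less.prems(1) trade(1) competitive_order(1,2)] by auto
    show ?thesis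
    proof (cases "qty \<alpha> \<le> qty ?m")
      case True
      let ?f = "\<lambda>b. if b = ?m then qty \<alpha> else 0"
      have "greedy_fill ?R (\<lambda>b. tradable b \<alpha>) B (qty \<alpha>) ?f 0"
        using greedy_fill_last less.prems(1) m trade True by metis
      moreover have "{b \<in> B. 0 < ?f b} = {?m}"
        using m(1) less.prems(4) by auto
      then have "bid_trades B (oid \<alpha>) ?f =
          {\<lparr>id_bid = oid ?m, id_ask = oid \<alpha>, tqty = qty \<alpha>\<rparr>}"
        unfolding bid_trades_def by simp
      moreover have "Match_Ask B A \<alpha> =
          ((if qty \<alpha> < qty ?m then {?m\<lparr>qty := qty ?m - qty \<alpha>\<rparr>} else {}) \<union> (B - {?m}), A,
           {\<lparr>id_bid = oid ?m, id_ask = oid \<alpha>, tqty = qty \<alpha>\<rparr>})"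
        using less.prems(1) trade True by (subst Match_Ask.simps) (auto simp: Let_def)
      ultimately show ?thesis
        using requantify_last[OF m(1) less.prems(3), of "qty \<alpha>"]
        by (intro exI[of _ ?f] exI[of _ 0]) simp
    next
      case False
      \<comment> \<open>The reduced order keeps its id and price, so tradability and the ids in the
        transactions are those of \<open>\<alpha>\<close>, and the fill of the recursive call can be
        reused.\<close>
      let ?\<alpha> = "\<alpha>\<lparr>qty := qty \<alpha> - qty ?m\<rparr>"
      have "card (B - {?m}) < card B"
        using m(1) less.prems(1) by (intro card_Diff1_less)
      moreover have "inj_on timestamp (B - {?m})"
        using less.prems(2) by (rule inj_on_subset) blast
      ultimately obtain f r where
        f: "greedy_fill ?R (\<lambda>b. tradable b ?\<alpha>) (B - {?m}) (qty ?\<alpha>) f r"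
        and run: "Match_Ask (B - {?m}) A ?\<alpha> = (requantify (B - {?m}) (\<lambda>b. qty b - f b),
          A \<union> (if 0 < r then {?\<alpha>\<lparr>qty := r\<rparr>} else {}), bid_trades (B - {?m}) (oid ?\<alpha>) f)"
        using less.hyps[of "B - {?m}" ?\<alpha>] less.prems False by auto
      let ?f = "f(?m := qty ?m)"
      have "greedy_fill ?R (\<lambda>b. tradable b \<alpha>) B (qty \<alpha>) ?f r"
        using f False less.prems(1) m trade(2)
        by (intro greedy_fill_step) (auto simp: tradable_def)
      moreover have "bid_trades B (oid \<alpha>) ?f = bid_trades (B - {?m}) (oid \<alpha>) f
          \<union> {\<lparr>id_bid = oid ?m, id_ask = oid \<alpha>, tqty = qty ?m\<rparr>}"
      proof -
        have "{b \<in> B. 0 < ?f b} = insert ?m {b \<in> B - {?m}. 0 < f b}"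
          using m(1) less.prems(3) by auto
        then show ?thesis
          unfolding bid_trades_def by (auto simp: image_iff)
      qed
      moreover have "Match_Ask B A \<alpha> = (requantify (B - {?m}) (\<lambda>b. qty b - f b),
          A \<union> (if 0 < r then {\<alpha>\<lparr>qty := r\<rparr>} else {}),
          bid_trades (B - {?m}) (oid \<alpha>) f \<union> {\<lparr>id_bid = oid ?m, id_ask = oid \<alpha>, tqty = qty ?m\<rparr>})"
        using less.prems(1) trade False run by (subst Match_Ask.simps) (simp add: Let_def)
      ultimately show ?thesis
        using requantify_step[OF m(1), of f]
        by (intro exI[of _ ?f] exI[of _ r]) simp
    qed
  qed
qed

text \<open>Mirror image of \<open>Match_Ask_greedy\<close>: the best ask has the lowest price, so
  if it is too expensive for \<open>\<beta>\<close>, every ask is.\<close>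

lemma Match_Bid_greedy:
  assumes "finite A" "inj_on timestamp A" "\<forall>a\<in>A. 0 < qty a" "0 < qty \<beta>"
  shows "\<exists>f r. greedy_fill ask_more_competitive (\<lambda>a. tradable \<beta> a) A (qty \<beta>) f r
    \<and> Match_Bid B A \<beta> = (B \<union> (if 0 < r then {\<beta>\<lparr>qty := r\<rparr>} else {}),
        requantify A (\<lambda>a. qty a - f a), ask_trades A (oid \<beta>) f)"
  using assms
proof (induction "card A" arbitrary: A \<beta> rule: less_induct)
  case less
  let ?R = ask_more_competitive
  let ?m = "most_competitive ?R A"
  consider (stop) "\<forall>a\<in>A. \<not> tradable \<beta> a" "A = {} \<or> \<not> tradable \<beta> ?m"
    | (trade) "A \<noteq> {}" "tradable \<beta> ?m"
  proof (cases "A = {} \<or> \<not> tradable \<beta> ?m")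
    case True
    have "\<not> tradable \<beta> a" if "a \<in> A" for a
    proof (cases "a = ?m")
      case False
      then have "?R ?m a"
        using most_competitive_ask(2)[OF less.prems(1) _ less.prems(2)] that by blast
      then show ?thesis
        using True that by (auto simp: tradable_def ask_more_competitive_def)
    qed (use True that in auto)
    then show ?thesis using that(1) True by blast
  qed (use that in blast)
  then show ?case
  proof cases
    case stop
    have "Match_Bid B A \<beta> = (B \<union> {\<beta>}, A, {})"
      using stop(2) by (subst Match_Bid.simps) (auto simp: Let_def)
    moreover have "requantify A (\<lambda>a. qty a - 0) = A"
      using less.prems by (intro requantify_same) auto
    moreover have "ask_trades A (oid \<beta>) (\<lambda>_. 0) = {}"
      by (simp add: ask_trades_def)
    ultimately show ?thesis
      using greedy_fill_stop[OF stop(1), of ?R "qty \<beta>"] less.prems(4)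
      by (intro exI[of _ "\<lambda>_. 0"] exI[of _ "qty \<beta>"]) simp
  next
    case trade
    have m: "?m \<in> A" "\<forall>a\<in>A. \<not> ?R a ?m"
      using most_competitive_maximal[OF less.prems(1) trade(1) competitive_order(3,4)] by auto
    show ?thesis
    proof (cases "qty \<beta> \<le> qty ?m")
      case True
      let ?f = "\<lambda>a. if a = ?m then qty \<beta> else 0"
      have "greedy_fill ?R (\<lambda>a. tradable \<beta> a) A (qty \<beta>) ?f 0"
        using greedy_fill_last less.prems(1) m trade True by metis
      moreover have "{a \<in> A. 0 < ?f a} = {?m}"
        using m(1) less.prems(4) by auto
      then have "ask_trades A (oid \<beta>) ?f =
          {\<lparr>id_bid = oid \<beta>, id_ask = oid ?m, tqty = qty \<beta>\<rparr>}"
        unfolding ask_trades_def by simp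
      moreover have "Match_Bid B A \<beta> =
          (B, (if qty \<beta> < qty ?m then {?m\<lparr>qty := qty ?m - qty \<beta>\<rparr>} else {}) \<union> (A - {?m}),
           {\<lparr>id_bid = oid \<beta>, id_ask = oid ?m, tqty = qty \<beta>\<rparr>})"
        using less.prems(1) trade True by (subst Match_Bid.simps) (auto simp: Let_def)
      ultimately show ?thesis
        using requantify_last[OF m(1) less.prems(3), of "qty \<beta>"]
        by (intro exI[of _ ?f] exI[of _ 0]) simp
    next
      case False
      let ?\<beta> = "\<beta>\<lparr>qty := qty \<beta> - qty ?m\<rparr>"
      have "card (A - {?m}) < card A"
        using m(1) less.prems(1) by (intro card_Diff1_less)
      moreover have "inj_on timestamp (A - {?m})"
        using less.prems(2) by (rule inj_on_subset) blast
      ultimately obtain f r where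
        f: "greedy_fill ?R (\<lambda>a. tradable ?\<beta> a) (A - {?m}) (qty ?\<beta>) f r"
        and run: "Match_Bid B (A - {?m}) ?\<beta> = (B \<union> (if 0 < r then {?\<beta>\<lparr>qty := r\<rparr>} else {}),
          requantify (A - {?m}) (\<lambda>a. qty a - f a), ask_trades (A - {?m}) (oid ?\<beta>) f)"
        using less.hyps[of "A - {?m}" ?\<beta>] less.prems False by auto
      let ?f = "f(?m := qty ?m)"
      have "greedy_fill ?R (\<lambda>a. tradable \<beta> a) A (qty \<beta>) ?f r"
        using f False less.prems(1) m trade(2)
        by (intro greedy_fill_step) (auto simp: tradable_def)
      moreover have "ask_trades A (oid \<beta>) ?f = ask_trades (A - {?m}) (oid \<beta>) f
          \<union> {\<lparr>id_bid = oid \<beta>, id_ask = oid ?m, tqty = qty ?m\<rparr>}"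
      proof -
        have "{a \<in> A. 0 < ?f a} = insert ?m {a \<in> A - {?m}. 0 < f a}"
          using m(1) less.prems(3) by auto
        then show ?thesis
          unfolding ask_trades_def by (auto simp: image_iff)
      qed
      moreover have "Match_Bid B A \<beta> = (B \<union> (if 0 < r then {\<beta>\<lparr>qty := r\<rparr>} else {}),
          requantify (A - {?m}) (\<lambda>a. qty a - f a),
          ask_trades (A - {?m}) (oid \<beta>) f \<union> {\<lparr>id_bid = oid \<beta>, id_ask = oid ?m, tqty = qty ?m\<rparr>})"
        using less.prems(1) trade False run by (subst Match_Bid.simps) (simp add: Let_def)
      ultimately show ?thesis
        using requantify_step[OF m(1), of f]
        by (intro exI[of _ ?f] exI[of _ r]) simp
    qed
  qed
qed

subsection \<open>Traded quantities\<close>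

text \<open>Filtered orders have multiplicity 0 and contribute the empty multiset, so the sum may
  run over all of \<open>S\<close>; keys are unaffected by a change of quantity.\<close>

lemma mset_of_orders_requantify:
  assumes "finite S" "inj_on oid S"
  shows "mset_of_orders (requantify S g) = (\<Sum>w\<in>S. replicate_mset (g w) (order_key w))"
proof -
  let ?h = "\<lambda>w::order. w\<lparr>qty := g w\<rparr>"
  \<comment> \<open>Overwriting quantities could merge orders that differ only in quantity; distinct
    ids exclude this.\<close>
  have inj: "inj_on ?h {w \<in> S. 0 < g w}"
  proof (rule inj_onI)
    fix x y assume xy: "x \<in> {w \<in> S. 0 < g w}" "y \<in> {w \<in> S. 0 < g w}" and "?h x = ?h y"
    then have "oid (?h x) = oid (?h y)" by simp
    then show "x = y" using xy assms(2) by (auto dest: inj_onD)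
  qed
  have "mset_of_orders (requantify S g) =
      (\<Sum>w\<in>{w \<in> S. 0 < g w}. replicate_mset (g w) (order_key w))"
    unfolding mset_of_orders_def requantify_def
    by (subst sum.reindex[OF inj]) (simp add: order_key_def)
  also have "\<dots> = (\<Sum>w\<in>S. replicate_mset (g w) (order_key w))"
    using assms(1) by (intro sum.mono_neutral_left) auto
  finally show ?thesis .
qed

text \<open>The multiset of \<open>S\<close> splits into the part given by \<open>f\<close> and the
  rest, so the difference cancels the first part exactly. The rest is finite with positive
  quantities and distinct ids, hence can be read back as a set of orders.\<close>

lemma order_diff_requantify:
  assumes "finite S" "inj_on oid S" "\<And>w. w \<in> S \<Longrightarrow> f w \<le> qty w"
  shows "order_diff S (requantify S f) = requantify S (\<lambda>w. qty w - f w)"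
proof -
  let ?rest = "requantify S (\<lambda>w. qty w - f w)"
  have "mset_of_orders S = (\<Sum>w\<in>S. replicate_mset (f w) (order_key w)
      + replicate_mset (qty w - f w) (order_key w))"
    unfolding mset_of_orders_def
    by (rule sum.cong)
      (simp_all add: assms(3) multiset_eq_iff)
  then have "mset_of_orders S = mset_of_orders (requantify S f) + mset_of_orders ?rest"
    by (simp add: mset_of_orders_requantify[OF assms(1,2)] sum.distrib)
  moreover have "finite ?rest" "\<forall>w\<in>?rest. 0 < qty w" "inj_on oid ?rest"
    using assms(1,2) by (auto simp: requantify_def inj_on_def)
  ultimately show ?thesis
    unfolding order_diff_def using orders_of_mset_of_orders[of ?rest] by simp
qed

text \<open>Since transactions have positive quantity, an id occurs in \<open>M\<close> exactly when
  its traded quantity is positive, so the two filters agree.\<close>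

lemma Bids_requantify:
  assumes "finite M" "\<forall>t\<in>M. 0 < tqty t"
  shows "Bids M B = requantify B (\<lambda>b. Qty_bid M (oid b))"
proof -
  have "0 < Qty_bid M i \<longleftrightarrow> i \<in> ids_bid M" for i
  proof -
    have "Qty_bid M i = 0 \<longleftrightarrow> (\<forall>t\<in>{t \<in> M. id_bid t = i}. tqty t = 0)"
      unfolding Qty_bid_def using assms(1) by (intro sum_eq_0_iff) simp
    then show ?thesis
      using assms(2) by (auto simp: ids_bid_def)
  qed
  then show ?thesis
    by (simp add: Bids_def requantify_def)
qed

lemma Asks_requantify:
  assumes "finite M" "\<forall>t\<in>M. 0 < tqty t"
  shows "Asks M A = requantify A (\<lambda>a. Qty_ask M (oid a))"
proof -
  have "0 < Qty_ask M i \<longleftrightarrow> i \<in> ids_ask M" for i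
  proof -
    have "Qty_ask M i = 0 \<longleftrightarrow> (\<forall>t\<in>{t \<in> M. id_ask t = i}. tqty t = 0)"
      unfolding Qty_ask_def using assms(1) by (intro sum_eq_0_iff) simp
    then show ?thesis
      using assms(2) by (auto simp: ids_ask_def)
  qed
  then show ?thesis
    by (simp add: Asks_def requantify_def)
qed

text \<open>Distinct ids give each bid at most one transaction, and all transactions share the ask
  id \<open>i\<close>.\<close>

lemma Qty_bid_trades:
  assumes "finite B" "inj_on oid B"
  shows "b \<in> B \<Longrightarrow> Qty_bid (bid_trades B i f) (oid b) = f b"
    and "Qty_ask (bid_trades B i f) j = (if j = i then sum f B else 0)"
proof -
  let ?t = "\<lambda>b. \<lparr>id_bid = oid b, id_ask = i, tqty = f b\<rparr>"
  show "Qty_bid (bid_trades B i f) (oid b) = f b" if "b \<in> B"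
  proof -
    have "{t \<in> bid_trades B i f. id_bid t = oid b} = (if 0 < f b then {?t b} else {})"
      using that assms(2) by (auto simp: bid_trades_def inj_on_eq_iff)
    then show ?thesis by (simp add: Qty_bid_def)
  qed
  \<comment> \<open>Identical transactions would collapse in a set and falsify the total; the bid
    ids keep them apart.\<close>
  have inj: "inj_on ?t {b \<in> B. 0 < f b}"
    using assms(2) by (auto simp: inj_on_def)
  have "(\<Sum>t\<in>bid_trades B i f. tqty t) = sum f {b \<in> B. 0 < f b}"
    unfolding bid_trades_def by (subst sum.reindex[OF inj]) simp
  also have "\<dots> = sum f B"
    using assms(1) by (intro sum.mono_neutral_left) auto
  finally have "(\<Sum>t\<in>bid_trades B i f. tqty t) = sum f B" .
  moreover have "{t \<in> bid_trades B i f. id_ask t = j} = (if j = i then bid_trades B i f else {})"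
    by (auto simp: bid_trades_def)
  ultimately show "Qty_ask (bid_trades B i f) j = (if j = i then sum f B else 0)"
    by (simp add: Qty_ask_def)
qed

lemma Qty_ask_trades:
  assumes "finite A" "inj_on oid A"
  shows "a \<in> A \<Longrightarrow> Qty_ask (ask_trades A i f) (oid a) = f a"
    and "Qty_bid (ask_trades A i f) j = (if j = i then sum f A else 0)"
proof -
  let ?t = "\<lambda>a. \<lparr>id_bid = i, id_ask = oid a, tqty = f a\<rparr>"
  show "Qty_ask (ask_trades A i f) (oid a) = f a" if "a \<in> A"
  proof -
    have "{t \<in> ask_trades A i f. id_ask t = oid a} = (if 0 < f a then {?t a} else {})"
      using that assms(2) by (auto simp: ask_trades_def inj_on_eq_iff)
    then show ?thesis by (simp add: Qty_ask_def)
  qed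
  have inj: "inj_on ?t {a \<in> A. 0 < f a}"
    using assms(2) by (auto simp: inj_on_def)
  have "(\<Sum>t\<in>ask_trades A i f. tqty t) = sum f {a \<in> A. 0 < f a}"
    unfolding ask_trades_def by (subst sum.reindex[OF inj]) simp
  also have "\<dots> = sum f A"
    using assms(1) by (intro sum.mono_neutral_left) auto
  finally have "(\<Sum>t\<in>ask_trades A i f. tqty t) = sum f A" .
  moreover have "{t \<in> ask_trades A i f. id_bid t = j} = (if j = i then ask_trades A i f else {})"
    by (auto simp: ask_trades_def)
  ultimately show "Qty_bid (ask_trades A i f) j = (if j = i then sum f A else 0)"
    by (simp add: Qty_bid_def)
qed

subsection \<open>Correctness of a single step\<close>

text \<open>Collects what the three properties demand of one run, so that each kind of instruction
  is analysed once.\<close>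

definition correct_outcome ::
  "order set \<Rightarrow> order set \<Rightarrow> order set \<times> order set \<times> transaction set \<Rightarrow> bool" where
  "correct_outcome B' A' out \<longleftrightarrow> (case out of (Bh, Ah, M) \<Rightarrow>
     \<not> matchable Bh Ah
     \<and> (\<forall>a\<in>A'. \<forall>a'\<in>A'. ask_more_competitive a a' \<and> oid a' \<in> ids_ask M
          \<longrightarrow> Qty_ask M (oid a) = qty a)
     \<and> (\<forall>b\<in>B'. \<forall>b'\<in>B'. bid_more_competitive b b' \<and> oid b' \<in> ids_bid M
          \<longrightarrow> Qty_bid M (oid b) = qty b)
     \<and> matching B' A' M
     \<and> Bh = order_diff B' (Bids M B') \<and> Ah = order_diff A' (Asks M A'))"

text \<open>A matching never overfills an order, so the multiset difference becomes plain
  subtraction of quantities, and conservation can be checked order by order.\<close>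

lemma matching_residuals:
  assumes "matching B A M" "finite M"
  shows "order_diff B (Bids M B) = requantify B (\<lambda>b. qty b - Qty_bid M (oid b))"
    and "order_diff A (Asks M A) = requantify A (\<lambda>a. qty a - Qty_ask M (oid a))"
proof -
  have pos: "\<forall>t\<in>M. 0 < tqty t"
    using assms(1) by (auto simp: matching_def valid_transaction_def)
  have "inj_on oid B" "inj_on oid A" "finite B" "finite A"
    using assms(1) by (auto simp: matching_def order_domain_def admissible_def intro: inj_on_subset)
  moreover have "\<And>b. b \<in> B \<Longrightarrow> Qty_bid M (oid b) \<le> qty b" "\<And>a. a \<in> A \<Longrightarrow> Qty_ask M (oid a) \<le> qty a"
    using assms(1) by (auto simp: matching_def)
  ultimately show "order_diff B (Bids M B) = requantify B (\<lambda>b. qty b - Qty_bid M (oid b))"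
    and "order_diff A (Asks M A) = requantify A (\<lambda>a. qty a - Qty_ask M (oid a))"
    unfolding Bids_requantify[OF assms(2) pos] Asks_requantify[OF assms(2) pos]
    by (simp_all add: order_diff_requantify)
qed

text \<open>A legal input may submit an order that already rests on its own side of the book, since
  absorbing it is then a set union without effect; hence the case \<open>x \<in> S\<close>.\<close>

lemma requantify_incoming:
  assumes "\<forall>w\<in>insert x S. 0 < qty w" "f x + r = qty x"
    and "\<And>w. w \<in> S \<Longrightarrow> w \<noteq> x \<Longrightarrow> f w = 0" "x \<in> S \<Longrightarrow> r = qty x"
  shows "requantify (insert x S) (\<lambda>w. qty w - f w) = S \<union> (if 0 < r then {x\<lparr>qty := r\<rparr>} else {})"
proof (cases "x \<in> S")
  case True
  \<comment> \<open>Here \<open>r = qty x\<close> forces \<open>f x = 0\<close>, so nothing is taken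
    and the posted remainder coincides with the resting copy of \<open>x\<close>.\<close>
  then have "f w = 0" if "w \<in> S" for w
    using that assms(2-4) by (cases "w = x") auto
  then have "requantify S (\<lambda>w. qty w - f w) = S"
    using assms(1) by (intro requantify_same) auto
  then show ?thesis
    using True assms by (auto simp: insert_absorb)
next
  case False
  then have "f w = 0" if "w \<in> S" for w
    using that assms(3) by auto
  then have "requantify S (\<lambda>w. qty w - f w) = S"
    using assms(1) by (intro requantify_same) auto
  moreover have "qty x - f x = r"
    using assms(2) by simp
  ultimately show ?thesis
    by (auto simp: requantify_insert)
qed

section \<open>Correctness of sell and buy instructions\<close>

lemma Match_Ask_correct:
  assumes "order_domain B A" "0 < qty \<alpha>" "\<not> matchable B A" "admissible B (A \<union> {\<alpha>})"
  shows "correct_outcome B (A \<union> {\<alpha>}) (Match_Ask B A \<alpha>)"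
proof -
  have fin: "finite B" "finite A" and pos: "\<forall>b\<in>B. 0 < qty b" "\<forall>a\<in>A. 0 < qty a"
    using assms(1) by (auto simp: order_domain_def)
  have inj: "inj_on oid B" "inj_on oid (insert \<alpha> A)" "inj_on timestamp B"
    using assms(4) unfolding admissible_def by (auto intro: inj_on_subset)
  obtain f r where
    f: "greedy_fill bid_more_competitive (\<lambda>b. tradable b \<alpha>) B (qty \<alpha>) f r"
    and run: "Match_Ask B A \<alpha> = (requantify B (\<lambda>b. qty b - f b),
        A \<union> (if 0 < r then {\<alpha>\<lparr>qty := r\<rparr>} else {}), bid_trades B (oid \<alpha>) f)"
    using Match_Ask_greedy[OF fin(1) inj(3) pos(1) assms(2)] by blast
  let ?M = "bid_trades B (oid \<alpha>) f"
  have le: "f b \<le> qty b" and ok: "0 < f b \<Longrightarrow> tradable b \<alpha>"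
    and prio: "b' \<in> B \<Longrightarrow> bid_more_competitive b b' \<Longrightarrow> 0 < f b' \<Longrightarrow> f b = qty b"
    and exhausted: "0 < r \<Longrightarrow> tradable b \<alpha> \<Longrightarrow> f b = qty b" if "b \<in> B" for b b'
    using f that unfolding greedy_fill_def by blast+
  have total: "sum f B + r = qty \<alpha>"
    using f by (simp add: greedy_fill_def)
  note Q = Qty_bid_trades[OF fin(1) inj(1)]
  have Q\<alpha>: "Qty_ask ?M (oid a) = (if a = \<alpha> then sum f B else 0)" if "a \<in> insert \<alpha> A" for a
    using inj_on_eq_iff[OF inj(2) that, of \<alpha>] by (simp add: Q(2))
  have no_trade: "\<not> tradable b a" if "b \<in> B" "a \<in> A" for b a
    using that assms(3) by (auto simp: matchable_def)

  \<comment> \<open>Resting pairs were not tradable before. A remainder of \<open>\<alpha>\<close>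
    is posted only for \<open>0 < r\<close>, and then every bid tradable with it has been emptied
    and filtered out.\<close>
  have spread: "\<not> matchable (requantify B (\<lambda>b. qty b - f b))
      (A \<union> (if 0 < r then {\<alpha>\<lparr>qty := r\<rparr>} else {}))"
    using no_trade exhausted
    by (fastforce simp: matchable_def requantify_def tradable_def split: if_splits)

  have ask_prio: False
    if prem: "a \<in> insert \<alpha> A" "a' \<in> insert \<alpha> A" "ask_more_competitive a a'" "oid a' \<in> ids_ask ?M"
    for a a'
  proof -
    obtain b where b: "b \<in> B" "0 < f b" "oid a' = oid \<alpha>"
      using prem(4) by (auto simp: ids_ask_def bid_trades_def)
    then have "a' = \<alpha>"
      using prem(2) inj_onD[OF inj(2)] by blast
    then have "a \<in> A" "price a \<le> price \<alpha>"
      using prem(1,3) by (auto simp: ask_more_competitive_def)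
    then show False
      using no_trade[OF b(1)] ok[OF b(1,2)] by (fastforce simp: tradable_def)
  qed

  have bid_prio: "Qty_bid ?M (oid b) = qty b"
    if "b \<in> B" "b' \<in> B" "bid_more_competitive b b'" "oid b' \<in> ids_bid ?M" for b b'
  proof -
    have "0 < f b'"
      using that(2,4) inj(1) by (auto simp: ids_bid_def bid_trades_def dest: inj_onD)
    then show ?thesis
      using that prio Q(1) by simp
  qed

  have "valid_transaction B (insert \<alpha> A) t" if t: "t \<in> ?M" for t
  proof -
    obtain b where b: "b \<in> B" "0 < f b" "t = \<lparr>id_bid = oid b, id_ask = oid \<alpha>, tqty = f b\<rparr>"
      using t by (auto simp: bid_trades_def)
    \<comment> \<open>A single share is at most the total taken, and hence at most
      \<open>qty \<alpha>\<close>, which is the ask-side bound in validity.\<close>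
    moreover have "f b \<le> sum f B"
      using b(1) fin(1) by (intro member_le_sum) auto
    ultimately show ?thesis
      using le[OF b(1)] ok[OF b(1,2)] total unfolding valid_transaction_def by auto
  qed
  then have matching: "matching B (insert \<alpha> A) ?M"
    using assms le total Q(1) Q\<alpha> by (auto simp: matching_def order_domain_def)

  have "finite ?M"
    using fin(1) by (simp add: bid_trades_def)
  note residuals = matching_residuals[OF matching this]
  have "order_diff B (Bids ?M B) = requantify B (\<lambda>b. qty b - f b)"
    unfolding residuals(1) by (rule requantify_cong) (simp add: Q(1))
  moreover have "order_diff (insert \<alpha> A) (Asks ?M (insert \<alpha> A)) =
      A \<union> (if 0 < r then {\<alpha>\<lparr>qty := r\<rparr>} else {})"
    unfolding residuals(2)
  proof (rule requantify_incoming)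
    \<comment> \<open>If \<open>\<alpha>\<close> already rests in the unmatchable book, no bid is
      tradable with it, so nothing is filled.\<close>
    show "r = qty \<alpha>" if "\<alpha> \<in> A"
    proof -
      have "sum f B = 0"
        using that no_trade ok by (intro sum.neutral) blast
      then show ?thesis using total by simp
    qed
  qed (use assms(2) pos(2) Q\<alpha> total in auto)
  ultimately show ?thesis
    unfolding correct_outcome_def run prod.case Un_insert_right Un_empty_right
    using spread ask_prio bid_prio matching by simp blast
qed

text \<open>Symmetric to \<open>Match_Ask_correct\<close>; now the shares \<open>f\<close> belong to
  resting asks, and the vacuous priority clause is the one on bids.\<close>

lemma Match_Bid_correct:
  assumes "order_domain B A" "0 < qty \<beta>" "\<not> matchable B A" "admissible (B \<union> {\<beta>}) A"
  shows "correct_outcome (B \<union> {\<beta>}) A (Match_Bid B A \<beta>)"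
proof -
  have fin: "finite A" "finite B" and pos: "\<forall>a\<in>A. 0 < qty a" "\<forall>b\<in>B. 0 < qty b"
    using assms(1) by (auto simp: order_domain_def)
  have inj: "inj_on oid A" "inj_on oid (insert \<beta> B)" "inj_on timestamp A"
    using assms(4) unfolding admissible_def by (auto intro: inj_on_subset)
  obtain f r where
    f: "greedy_fill ask_more_competitive (\<lambda>a. tradable \<beta> a) A (qty \<beta>) f r"
    and run: "Match_Bid B A \<beta> = (B \<union> (if 0 < r then {\<beta>\<lparr>qty := r\<rparr>} else {}),
        requantify A (\<lambda>a. qty a - f a), ask_trades A (oid \<beta>) f)"
    using Match_Bid_greedy[OF fin(1) inj(3) pos(1) assms(2)] by blast
  let ?M = "ask_trades A (oid \<beta>) f"
  have le: "f a \<le> qty a" and ok: "0 < f a \<Longrightarrow> tradable \<beta> a"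
    and prio: "a' \<in> A \<Longrightarrow> ask_more_competitive a a' \<Longrightarrow> 0 < f a' \<Longrightarrow> f a = qty a"
    and exhausted: "0 < r \<Longrightarrow> tradable \<beta> a \<Longrightarrow> f a = qty a" if "a \<in> A" for a a'
    using f that unfolding greedy_fill_def by blast+
  have total: "sum f A + r = qty \<beta>"
    using f by (simp add: greedy_fill_def)
  note Q = Qty_ask_trades[OF fin(1) inj(1)]
  have Q\<beta>: "Qty_bid ?M (oid b) = (if b = \<beta> then sum f A else 0)" if "b \<in> insert \<beta> B" for b
    using inj_on_eq_iff[OF inj(2) that, of \<beta>] by (simp add: Q(2))
  have no_trade: "\<not> tradable b a" if "b \<in> B" "a \<in> A" for b a
    using that assms(3) by (auto simp: matchable_def)

  have spread: "\<not> matchable (B \<union> (if 0 < r then {\<beta>\<lparr>qty := r\<rparr>} else {}))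
      (requantify A (\<lambda>a. qty a - f a))"
    using no_trade exhausted
    by (fastforce simp: matchable_def requantify_def tradable_def split: if_splits)

  have bid_prio: False
    if prem: "b \<in> insert \<beta> B" "b' \<in> insert \<beta> B" "bid_more_competitive b b'" "oid b' \<in> ids_bid ?M"
    for b b'
  proof -
    obtain a where a: "a \<in> A" "0 < f a" "oid b' = oid \<beta>"
      using prem(4) by (auto simp: ids_bid_def ask_trades_def)
    then have "b' = \<beta>"
      using prem(2) inj_onD[OF inj(2)] by blast
    then have "b \<in> B" "price \<beta> \<le> price b"
      using prem(1,3) by (auto simp: bid_more_competitive_def)
    then show False
      using no_trade[OF _ a(1)] ok[OF a(1,2)] by (fastforce simp: tradable_def)
  qed

  have ask_prio: "Qty_ask ?M (oid a) = qty a"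
    if "a \<in> A" "a' \<in> A" "ask_more_competitive a a'" "oid a' \<in> ids_ask ?M" for a a'
  proof -
    have "0 < f a'"
      using that(2,4) inj(1) by (auto simp: ids_ask_def ask_trades_def dest: inj_onD)
    then show ?thesis
      using that prio Q(1) by simp
  qed

  have "valid_transaction (insert \<beta> B) A t" if t: "t \<in> ?M" for t
  proof -
    obtain a where a: "a \<in> A" "0 < f a" "t = \<lparr>id_bid = oid \<beta>, id_ask = oid a, tqty = f a\<rparr>"
      using t by (auto simp: ask_trades_def)
    moreover have "f a \<le> sum f A"
      using a(1) fin(1) by (intro member_le_sum) auto
    ultimately show ?thesis
      using le[OF a(1)] ok[OF a(1,2)] total unfolding valid_transaction_def by auto
  qed
  then have matching: "matching (insert \<beta> B) A ?M"
    using assms le total Q(1) Q\<beta> by (auto simp: matching_def order_domain_def)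

  have "finite ?M"
    using fin(1) by (simp add: ask_trades_def)
  note residuals = matching_residuals[OF matching this]
  have "order_diff A (Asks ?M A) = requantify A (\<lambda>a. qty a - f a)"
    unfolding residuals(2) by (rule requantify_cong) (simp add: Q(1))
  moreover have "order_diff (insert \<beta> B) (Bids ?M (insert \<beta> B)) =
      B \<union> (if 0 < r then {\<beta>\<lparr>qty := r\<rparr>} else {})"
    unfolding residuals(1)
  proof (rule requantify_incoming)
    show "r = qty \<beta>" if "\<beta> \<in> B"
    proof -
      have "sum f A = 0"
        using that no_trade ok by (intro sum.neutral) blast
      then show ?thesis using total by simp
    qed
  qed (use assms(2) pos(2) Q\<beta> total in auto)
  ultimately show ?thesis
    unfolding correct_outcome_def run prod.case Un_insert_right Un_empty_right
    using spread ask_prio bid_prio matching by simp blast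
qed

text \<open>Serves deletions, which return the absorbed book unchanged; with no ids in the empty
  matching, both priority clauses are vacuous.\<close>

lemma no_trade_correct:
  assumes "order_domain B A" "\<not> matchable B A" "admissible B A"
  shows "correct_outcome B A (B, A, {})"
proof -
  have matching: "matching B A {}"
    using assms by (simp add: matching_def Qty_bid_def Qty_ask_def)
  have "requantify S (\<lambda>w. qty w - 0) = S" if "\<forall>w\<in>S. 0 < qty w" for S
    using that by (intro requantify_same) auto
  then have "order_diff B (Bids {} B) = B" "order_diff A (Asks {} A) = A"
    using assms(1) matching_residuals[OF matching]
    by (simp_all add: Qty_bid_def Qty_ask_def order_domain_def)
  then show ?thesis
    using assms(2) matching by (simp add: correct_outcome_def ids_bid_def ids_ask_def)
qed

section \<open>All instructions and the three properties\<close>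

lemma Process_instruction_correct:
  assumes "legal_input B A \<tau>" "Absorb B A \<tau> = (B', A')"
  shows "correct_outcome B' A' (Process_instruction B A \<tau>)"
proof (cases \<tau>)
  case (Buy \<beta>)
  then show ?thesis
    using assms Match_Bid_correct by (auto simp: legal_input_def)
next
  case (Sell \<alpha>)
  then show ?thesis
    using assms Match_Ask_correct by (auto simp: legal_input_def)
next
  case (Del i)
  \<comment> \<open>Deletion shrinks both sides, which preserves finiteness, positivity and
    unmatchability; admissibility of the absorbed book is part of legality.\<close>
  then have "order_domain B' A'" "\<not> matchable B' A'" "admissible B' A'"
    using assms by (auto simp: legal_input_def order_domain_def matchable_def)
  then show ?thesis
    using no_trade_correct assms(2) Del by (auto simp: Del_Order_def)
qed

theorem theorem3:
  shows "positive_bid_ask_spread Process_instruction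
    \<and> price_time_priority Process_instruction
    \<and> conservation Process_instruction"
proof -
  have step: "correct_outcome B' A' (Bh, Ah, M)"
    if "legal_input B A \<tau>" "Process_instruction B A \<tau> = (Bh, Ah, M)" "Absorb B A \<tau> = (B', A')"
    for B A \<tau> Bh Ah M B' A'
    using Process_instruction_correct that by metis
  have "positive_bid_ask_spread Process_instruction"
    unfolding positive_bid_ask_spread_def
  proof (intro allI impI)
    fix B A \<tau> Bh Ah M
    assume "legal_input B A \<tau>" "Process_instruction B A \<tau> = (Bh, Ah, M)"
    \<comment> \<open>The spread property does not mention the absorbed book, so the case split
      supplies the \<open>B'\<close> and \<open>A'\<close> at which \<open>step\<close> is
      applied.\<close>
    then show "\<not> matchable Bh Ah"
      using step by (cases "Absorb B A \<tau>") (force simp: correct_outcome_def)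
  qed
  moreover have "price_time_priority Process_instruction"
    unfolding price_time_priority_def
    using step unfolding correct_outcome_def prod.case by blast
  moreover have "conservation Process_instruction"
    unfolding conservation_def
    using step unfolding correct_outcome_def prod.case by blast
  ultimately show ?thesis by blast
qed

end
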